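(* Let $L$ be a pce language over a finite totally ordered alphabet. If the carry propagation $\mathsf{CP}_L$ exists, then the local growth rate $\gamma_L$ exists and $$\mathsf{CP}_L=\frac{\gamma_L}{\gamma_L-1}.$$
   Context: $A=\{0,1,\ldots,r-1\}$ is a finite alphabet with its natural order, $A^*$ the set of words over $A$, $|w|$ the length of $w$. The radix order on $A^*$: $v$ is less than $w$ if $|v|<|w|$, or if $|v|=|w|$ and $v$ is lexicographically less than $w$. A language $L\subseteq A^*$ is a pce language if every prefix of a word of $L$ is in $L$ and every word of $L$ is a strict prefix of another word of $L$. Languages considered are infinite (for a pce language, this means non-empty). Enumerate $L$ in increasing radix order as $w_0,w_1,w_2,\ldots$; write $\langle i\rangle_L=w_i$ and $\mathrm{Succ}_L(w_i)=w_{i+1}$. For words $u,v$: if $|u|=|v|$, $\Delta(u,v)$ is $|u|$ minus the length of the longest common prefix of $u$ and $v$; if $|u|\neq|v|$, $\Delta(u,v)=\max(|u|,|v|)$. The carry propagation at $w\in L$ is $\mathsf{cp}_L(w)=\Delta(w,\mathrm{Succ}_L(w))$, and $\mathsf{cp}_L(i)=\mathsf{cp}_L(\langle i\rangle_L)$ for $i\in\mathbb{N}$. The carry propagation of $L$ is the (finite) limit, if it exists, $\mathsf{CP}_L=\lim_{N\to\infty}\frac1N\sum_{i=0}^{N-1}\mathsf{cp}_L(i)$. Let $\mathbf{u}_L(\ell)$ be the number of words of $L$ of length $\ell$. The local growth rate of $L$ is the (finite) limit, if it exists, $\gamma_L=\lim_{\ell\to\infty}\mathbf{u}_L(\ell+1)/\mathbf{u}_L(\ell)$.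 *)

theory Defs
  imports Complex_Main "HOL-Library.Sublist"
begin

definition radix_less :: "'a::linorder list \<Rightarrow> 'a list \<Rightarrow> bool" where
  "radix_less v w \<longleftrightarrow> (v, w) \<in> lenlex {(a, b). a < b}"

text \<open>Unfolded: shorter words come first, and words of equal length are compared at the first
  position where they differ.\<close>

lemma radix_less_iff:
  "radix_less v w \<longleftrightarrow>
     length v < length w \<or>
     length v = length w \<and>
       (\<exists>xs a b vs ws. a < b \<and> v = xs @ a # vs \<and> w = xs @ b # ws)"
  unfolding radix_less_def lenlex_conv lex_conv by auto

definition pce :: "'a list set \<Rightarrow> bool" where
  "pce L \<longleftrightarrow>
     (\<forall>w\<in>L. \<forall>u. prefix u w \<longrightarrow> u \<in> L) \<and>
     (\<forall>w\<in>L. \<exists>v\<in>L. strict_prefix w v)"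

definition radix_enumerates :: "'a::linorder list set \<Rightarrow> (nat \<Rightarrow> 'a list) \<Rightarrow> bool" where
  "radix_enumerates L w \<longleftrightarrow> range w = L \<and> (\<forall>i j. i < j \<longrightarrow> radix_less (w i) (w j))"

definition nth_word :: "'a::linorder list set \<Rightarrow> nat \<Rightarrow> 'a list" where
  "nth_word L = (THE w. radix_enumerates L w)"

lemma ex1_radix_enumerates:
  fixes A :: "'a::linorder set"
  assumes "finite A" "L \<subseteq> lists A" "infinite L"
  shows "\<exists>!w. radix_enumerates L w"
proof -
  define g where "g w = card {v \<in> L. radix_less v w}" for w
  have fin: "finite {v \<in> L. radix_less v w}" for w
  proof (rule finite_subset[OF _ finite_lists_length_le[OF assms(1), of "length w"]])
    show "{v \<in> L. radix_less v w} \<subseteq> {xs. set xs \<subseteq> A \<and> length xs \<le> length w}"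
      using assms(2) by (auto simp: radix_less_iff)
  qed
  have irr: "\<not> radix_less v v" for v :: "'a list"
    unfolding radix_less_def by (rule lenlex_irreflexive) auto
  have "trans (lenlex {(a::'a, b). a < b})"
    by (rule lenlex_transI) (auto simp: trans_def)
  then have tr: "radix_less u v \<Longrightarrow> radix_less v w \<Longrightarrow> radix_less u w" for u v w :: "'a list"
    unfolding radix_less_def by (rule transD)
  have "total (lenlex {(a::'a, b). a < b})"
    by (rule total_lenlex) (auto simp: total_on_def)
  then have tot: "v \<noteq> w \<Longrightarrow> radix_less v w \<or> radix_less w v" for v w :: "'a list"
    unfolding radix_less_def by (simp add: total_on_def)
  have mono: "g v < g w" if "v \<in> L" "radix_less v w" for v w
    unfolding g_def by (rule psubset_card_mono[OF fin]) (use that irr tr in blast)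
  have inj: "inj_on g L"
    by (rule inj_onI) (metis mono tot less_irrefl)
  have down: "\<exists>v\<in>L. g v = i" if "w \<in> L" "i \<le> g w" for w i
    using that
  proof (induction "g w" arbitrary: w rule: less_induct)
    case less
    show ?case
    proof (cases "i = g w")
      case False
      let ?P = "{v \<in> L. radix_less v w}"
      have lt: "i < g w" using False less.prems by simp
      have "?P \<noteq> {}"
        using lt unfolding g_def by (metis card.empty not_less_zero)
      then obtain p where p: "p \<in> ?P" "g p = Max (g ` ?P)"
        using Max_in[of "g ` ?P"] fin by fastforce
      have "?P \<subseteq> insert p {v \<in> L. radix_less v p}"
      proof
        fix v assume v: "v \<in> ?P"
        then have "g v \<le> g p" using fin p by simp
        then show "v \<in> insert p {v \<in> L. radix_less v p}"
          using v p(1) mono[of p v] tot[of v p] by fastforce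
      qed
      then have "g w \<le> Suc (g p)"
        using fin[of p] irr[of p] card_mono[of "insert p {v \<in> L. radix_less v p}" ?P]
        by (simp add: g_def)
      then show ?thesis
        using less.hyps[of p] p(1) mono[of p w] lt by auto
    qed (use less.prems in auto)
  qed
  have surj: "g ` L = UNIV"
  proof -
    have "infinite (g ` L)" using inj assms(3) finite_imageD by blast
    then have "\<exists>m\<in>g ` L. i \<le> m" for i
      by (meson finite_nat_set_iff_bounded_le nat_le_linear)
    then show ?thesis using down by (metis UNIV_eq_I image_iff)
  qed
  have bij: "bij_betw g L UNIV" using inj surj by (simp add: bij_betw_def)
  define f where "f = inv_into L g"
  have fL: "f i \<in> L" and gf: "g (f i) = i" for i
    using surj by (auto simp: f_def inv_into_into f_inv_into_f)
  have "radix_enumerates L f"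
    unfolding radix_enumerates_def
  proof (intro conjI allI impI)
    show "range f = L"
      using bij_betw_inv_into[OF bij] by (simp add: f_def bij_betw_def)
    fix i j :: nat assume "i < j"
    then show "radix_less (f i) (f j)"
      by (metis fL gf mono tot less_asym less_irrefl)
  qed
  moreover have "h = f" if h: "radix_enumerates L h" for h
  proof
    fix i
    have hL: "h k \<in> L" for k using h by (auto simp: radix_enumerates_def)
    have hm: "radix_less (h k) (h l) \<longleftrightarrow> k < l" for k l
      using h irr tr unfolding radix_enumerates_def by (metis linorder_neqE_nat)
    have "inj h" by (rule injI) (metis hm irr linorder_neqE_nat)
    have "{v \<in> L. radix_less v (h i)} = h ` {..<i}"
      using h hm by (auto simp: radix_enumerates_def)
    then have "g (h i) = i"
      using \<open>inj h\<close> by (simp add: g_def card_image inj_on_subset)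
    then show "h i = f i"
      using inj fL gf hL by (metis inj_onD)
  qed
  ultimately show ?thesis by blast
qed

definition Succ_word :: "'a::linorder list set \<Rightarrow> 'a list \<Rightarrow> 'a list" where
  "Succ_word L w = nth_word L (Suc (THE i. nth_word L i = w))"

definition Delta :: "'a list \<Rightarrow> 'a list \<Rightarrow> nat" where
  "Delta u v =
     (if length u = length v then length u - length (longest_common_prefix u v)
      else max (length u) (length v))"

definition cp_word :: "'a::linorder list set \<Rightarrow> 'a list \<Rightarrow> nat" where
  "cp_word L w = Delta w (Succ_word L w)"

definition cp :: "'a::linorder list set \<Rightarrow> nat \<Rightarrow> nat" where
  "cp L i = cp_word L (nth_word L i)"

definition cp_mean :: "'a::linorder list set \<Rightarrow> nat \<Rightarrow> real" where
  "cp_mean L N = (1 / real N) * (\<Sum>i<N. real (cp L i))"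

text \<open>The constants \<open>CP\<close> and \<open>local_growth_rate\<close> are meaningful only when the underlying
  sequence is \<^const>\<open>convergent\<close>; existence of the limit always has to be stated separately.\<close>

definition CP :: "'a::linorder list set \<Rightarrow> real" where
  "CP L = lim (cp_mean L)"

definition num_words :: "'a list set \<Rightarrow> nat \<Rightarrow> nat" where
  "num_words L l = card {w \<in> L. length w = l}"

definition growth_ratio :: "'a list set \<Rightarrow> nat \<Rightarrow> real" where
  "growth_ratio L l = real (num_words L (Suc l)) / real (num_words L l)"

definition local_growth_rate :: "'a list set \<Rightarrow> real" where
  "local_growth_rate L = lim (growth_ratio L)"

end

theory Submission
  imports Defs
begin

text \<open>
  Write \<open>v l\<close> for the number of words of \<open>L\<close> of length at most \<open>l\<close>. These words are exactly the
  first \<open>v l\<close> words in radix order. The carry propagation from a word to its successor is the number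
  of \<open>j\<close> such that the two words still differ after their last \<open>j\<close> letters have been erased
  (\<open>Delta_eq_card_trim\<close>); this description covers words of equal length and the passage from one length
  to the next alike. Erasing \<open>j\<close> letters is monotone for the radix order
  (\<open>trim_mono\<close>), and for a pce language it maps the words of length at most \<open>l\<close> onto those of length
  at most \<open>l - j\<close> (\<open>trim_short_words\<close>). Hence, as the words run from the first one up to
  the first one of length \<open>l + 1\<close>, the erased word changes exactly \<open>v (l - j)\<close> times for each
  \<open>j \<le> l\<close>, and counting the pairs (word, \<open>j\<close>) in two ways gives
  (\<open>sum_cp_short_words\<close>)
  \[ \sum_{i < v(l)} \mathsf{cp}_L(i) = s(l), \qquad s(l) = \sum_{k \le l} v(k). \]

  If the carry propagation \<open>C\<close> exists, then \<open>s l / v l\<close> tends to \<open>C\<close>. Since the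
  alphabet is finite, \<open>v (l + 1) \<le> K * v l\<close> for some \<open>K\<close>, which forces \<open>C > 1\<close>. As
  \<open>s l = s (l + 1) - v (l + 1)\<close>, the ratio \<open>v (l + 1) / v l\<close> is a continuous function of two consecutive
  terms of \<open>s l / v l\<close> and tends to \<open>C / (C - 1)\<close> (\<open>ratio_limit_of_partial_sum_ratio\<close>). The
  differences \<open>v (l + 1) - v l\<close>, which count the words of length \<open>l + 1\<close>, have the same ratio limit
  (\<open>ratio_limit_of_differences\<close>), and \<open>\<gamma> = C / (C - 1)\<close> is equivalent to \<open>C = \<gamma> / (\<gamma> - 1)\<close>.
\<close>

section \<open>Ratio limits of real sequences\<close>

text \<open>The partial sum up to \<open>l + 1\<close> exceeds its last term \<open>v (l + 1)\<close> by at least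
  \<open>v l \<ge> v (l + 1) / K\<close>, so the limit is at least \<open>1 + 1 / K\<close>. Without such a bound \<open>v\<close> could grow
  faster than geometrically and \<open>C\<close> could be \<open>1\<close>.\<close>

lemma ratio_limit_of_partial_sum_ratio:
  fixes v :: "nat \<Rightarrow> real"
  assumes pos: "\<And>l. v l > 0"
    and bound: "\<And>l. v (Suc l) \<le> K * v l"
    and lim: "(\<lambda>l. (\<Sum>k\<le>l. v k) / v l) \<longlonglongrightarrow> C"
  shows "C > 1" and "(\<lambda>l. v (Suc l) / v l) \<longlonglongrightarrow> C / (C - 1)"
proof -
  define s where "s l = (\<Sum>k\<le>l. v k)" for l
  have s_Suc: "s (Suc l) = s l + v (Suc l)" for l
    by (simp add: s_def)
  have s_ge: "v l \<le> s l" for l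
    unfolding s_def using pos by (intro member_le_sum) (auto intro: less_imp_le)
  have lim_s: "(\<lambda>l. s l / v l) \<longlonglongrightarrow> C"
    using lim by (simp add: s_def)
  have K: "K > 0"
    using bound[of 0] pos[of 0] pos[of "Suc 0"] by (smt (verit) mult_nonpos_nonneg)
  have "1 + 1 / K \<le> s (Suc l) / v (Suc l)" for l
  proof -
    have "v (Suc l) / K \<le> v l"
      using bound[of l] K by (simp add: field_simps)
    then have "v (Suc l) / K \<le> s l"
      using s_ge[of l] by simp
    then have "(1 + 1 / K) * v (Suc l) \<le> s (Suc l)"
      by (simp add: s_Suc algebra_simps)
    then show ?thesis
      using pos[of "Suc l"] by (simp add: pos_le_divide_eq)
  qed
  then have "1 + 1 / K \<le> C"
    using LIMSEQ_le_const[OF LIMSEQ_Suc[OF lim_s]] by blast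
  moreover have "1 / K > 0"
    using K by simp
  ultimately show C: "C > 1"
    by linarith
  have "(\<lambda>l. (s l / v l) / (s (Suc l) / v (Suc l) - 1)) \<longlonglongrightarrow> C / (C - 1)"
    using C by (intro tendsto_intros lim_s LIMSEQ_Suc[OF lim_s]) auto
  moreover have "(s l / v l) / (s (Suc l) / v (Suc l) - 1) = v (Suc l) / v l" for l
    using pos[of l] pos[of "Suc l"] s_ge[of l] by (simp add: s_Suc field_simps)
  ultimately show "(\<lambda>l. v (Suc l) / v l) \<longlonglongrightarrow> C / (C - 1)"
    by simp
qed

text \<open>With \<open>q l = v (l + 1) / v l\<close>, the quotient of consecutive differences is
  \<open>(q (l + 1) - 1) / (1 - 1 / q l)\<close>; \<open>g \<noteq> 1\<close> keeps the limit of the denominator away from \<open>0\<close>.\<close>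

lemma ratio_limit_of_differences:
  fixes v :: "nat \<Rightarrow> real"
  assumes pos: "\<And>l. v l > 0"
    and lim: "(\<lambda>l. v (Suc l) / v l) \<longlonglongrightarrow> g" and g: "g > 1"
  shows "(\<lambda>l. (v (Suc (Suc l)) - v (Suc l)) / (v (Suc l) - v l)) \<longlonglongrightarrow> g"
proof -
  have "(\<lambda>l. (v (Suc (Suc l)) / v (Suc l) - 1) / (1 - 1 / (v (Suc l) / v l)))
      \<longlonglongrightarrow> (g - 1) / (1 - 1 / g)"
    using g by (intro tendsto_intros lim LIMSEQ_Suc[OF lim]) (auto simp: field_simps)
  moreover have "(v (Suc (Suc l)) / v (Suc l) - 1) / (1 - 1 / (v (Suc l) / v l))
      = (v (Suc (Suc l)) - v (Suc l)) / (v (Suc l) - v l)" for l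
    using pos[of l] pos[of "Suc l"] by (simp add: divide_simps)
  moreover have "(g - 1) / (1 - 1 / g) = g"
    using g by (simp add: divide_simps)
  ultimately show ?thesis
    by simp
qed

section \<open>Erasing final letters\<close>

definition trim :: "nat \<Rightarrow> 'a list \<Rightarrow> 'a list" where
  "trim j w = take (length w - j) w"

lemma length_trim [simp]: "length (trim j w) = length w - j"
  by (simp add: trim_def)

lemma prefix_trim: "prefix (trim j w) w"
  by (simp add: trim_def take_is_prefix)

lemma radix_less_irrefl: "\<not> radix_less v v"
  unfolding radix_less_def by (rule lenlex_irreflexive) auto

lemma radix_less_trans: "radix_less u v \<Longrightarrow> radix_less v w \<Longrightarrow> radix_less u w"
proof -
  have "trans (lenlex {(a::'a, b). a < b})"
    by (rule lenlex_transI) (auto simp: trans_def)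
  then show "radix_less u v \<Longrightarrow> radix_less v w \<Longrightarrow> radix_less u w"
    unfolding radix_less_def by (rule transD)
qed

lemma trim_mono:
  assumes "radix_less v w"
  shows "trim j v = trim j w \<or> radix_less (trim j v) (trim j w)"
proof (cases "length v < length w")
  case True
  then show ?thesis
    by (cases "j < length w") (auto simp: radix_less_iff trim_def)
next
  case False
  then obtain xs a b vs ws where len: "length v = length w" and ab: "a < b"
    and v: "v = xs @ a # vs" and w: "w = xs @ b # ws"
    using assms by (auto simp: radix_less_iff)
  define m where "m = length w - j"
  have tr: "trim j v = take m v" "trim j w = take m w"
    by (simp_all add: trim_def m_def len)
  show ?thesis
  proof (cases "m \<le> length xs")
    case True
    then have "take m v = take m w"
      by (simp add: v w)
    then show ?thesis
      by (simp add: tr)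
  next
    case False
    then obtain n where "m = length xs + Suc n"
      by (metis add_Suc_right less_imp_Suc_add not_le)
    then have "take m v = xs @ a # take n vs" "take m w = xs @ b # take n ws"
      by (simp_all add: v w)
    moreover have "length (take m v) = length (take m w)"
      by (simp add: len)
    ultimately show ?thesis
      using ab unfolding tr radix_less_iff by metis
  qed
qed

lemma take_eq_iff_le_longest_common_prefix:
  assumes "m \<le> length u" "m \<le> length v"
  shows "take m u = take m v \<longleftrightarrow> m \<le> length (longest_common_prefix u v)"
proof
  assume "take m u = take m v"
  then have "prefix (take m u) (longest_common_prefix u v)"
    by (metis longest_common_prefix_max_prefix take_is_prefix)
  then show "m \<le> length (longest_common_prefix u v)"
    using prefix_length_le assms by fastforce
next
  assume m: "m \<le> length (longest_common_prefix u v)"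
  obtain x y where "u = longest_common_prefix u v @ x" "v = longest_common_prefix u v @ y"
    by (metis longest_common_prefix_prefix1 longest_common_prefix_prefix2 prefixE)
  then show "take m u = take m v"
    using m by (metis append_Nil2 diff_is_0_eq take0 take_append)
qed

text \<open>For equal lengths, erasing \<open>j\<close> letters makes the words equal exactly when what remains lies
  within the longest common prefix. Passing from length \<open>n\<close> to length \<open>n + 1\<close>, the erased
  words have different lengths for every
  \<open>j \<le> n\<close> and are both empty from \<open>j = n + 1\<close> on; this accounts for the value \<open>n + 1\<close> of \<open>Delta\<close>.\<close>

lemma Delta_eq_card_trim:
  assumes "length v = length u \<or> length v = Suc (length u)"
  shows "Delta u v = card {j. trim j u \<noteq> trim j v}"
  using assms
proof
  assume len: "length v = length u"
  let ?c = "length (longest_common_prefix u v)"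
  have "trim j u \<noteq> trim j v \<longleftrightarrow> j < length u - ?c" for j
    using take_eq_iff_le_longest_common_prefix[of "length u - j" u v] len
      prefix_length_le[OF longest_common_prefix_prefix1[of u v]]
    by (auto simp: trim_def)
  then have "{j. trim j u \<noteq> trim j v} = {..<length u - ?c}"
    by auto
  then show ?thesis
    by (simp add: Delta_def len)
next
  assume len: "length v = Suc (length u)"
  have "trim j u \<noteq> trim j v \<longleftrightarrow> j < length v" for j
  proof (cases "j < length v")
    case True
    then have "length (trim j u) \<noteq> length (trim j v)"
      by (simp add: len)
    then show ?thesis
      using True by metis
  qed (simp add: trim_def len)
  then have "{j. trim j u \<noteq> trim j v} = {..<length v}"
    by auto
  then show ?thesis
    by (simp add: Delta_def len)
qed

section \<open>Words of bounded length in a pce language\<close>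

definition short_words :: "'a list set \<Rightarrow> nat \<Rightarrow> 'a list set" where
  "short_words L l = {w \<in> L. length w \<le> l}"

lemma finite_short_words:
  assumes "finite A" "L \<subseteq> lists A"
  shows "finite (short_words L l)"
proof (rule finite_subset[OF _ finite_lists_length_le[OF assms(1), of l]])
  show "short_words L l \<subseteq> {xs. set xs \<subseteq> A \<and> length xs \<le> l}"
    using assms(2) by (auto simp: short_words_def)
qed

lemma pce_prefix: "pce L \<Longrightarrow> w \<in> L \<Longrightarrow> prefix u w \<Longrightarrow> u \<in> L"
  by (auto simp: pce_def)

lemma pce_Nil: "pce L \<Longrightarrow> L \<noteq> {} \<Longrightarrow> [] \<in> L"
  by (meson Nil_prefix all_not_in_conv pce_prefix)

lemma pce_extension:
  assumes "pce L" "w \<in> L"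
  shows "\<exists>x \<in> L. prefix w x \<and> length x = length w + j"
proof (induction j)
  case 0
  show ?case
    using assms by auto
next
  case (Suc j)
  then obtain x where x: "x \<in> L" "prefix w x" "length x = length w + j"
    by blast
  then obtain y where y: "y \<in> L" "strict_prefix x y"
    using assms(1) by (auto simp: pce_def)
  let ?z = "take (Suc (length x)) y"
  have len: "length x < length y"
    using y(2) by (rule prefix_length_less)
  have "?z \<in> L"
    by (rule pce_prefix[OF assms(1) y(1) take_is_prefix])
  moreover have "prefix x ?z"
    using y(2) len prefix_length_prefix[of x y ?z] take_is_prefix[of "Suc (length x)" y]
    by (simp add: strict_prefix_def)
  then have "prefix w ?z"
    using x(2) prefix_order.trans by blast
  moreover have "length ?z = length w + Suc j"
    using len x(3) by simp
  ultimately show ?case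
    by blast
qed

lemma pce_word_of_length:
  assumes "pce L" "L \<noteq> {}"
  shows "\<exists>w \<in> L. length w = l"
  using pce_extension[OF assms(1) pce_Nil[OF assms], of l] by auto

lemma pce_infinite:
  assumes "pce L" "L \<noteq> {}"
  shows "infinite L"
proof
  assume "finite L"
  then have "finite (length ` L)"
    by simp
  moreover have "length ` L = UNIV"
    using pce_word_of_length[OF assms] by (metis UNIV_eq_I imageI)
  ultimately show False
    by simp
qed

text \<open>Surjectivity is where extendability enters: a word of length at most \<open>l - j\<close> is obtained by
  erasing \<open>j\<close> letters from one of its extensions by \<open>j\<close> letters.\<close>

lemma trim_short_words:
  assumes "pce L" "j \<le> l"
  shows "trim j ` short_words L l = short_words L (l - j)"
proof
  show "trim j ` short_words L l \<subseteq> short_words L (l - j)"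
    using pce_prefix[OF assms(1) _ prefix_trim] by (auto simp: short_words_def)
  show "short_words L (l - j) \<subseteq> trim j ` short_words L l"
  proof
    fix w assume w: "w \<in> short_words L (l - j)"
    then obtain x where x: "x \<in> L" "prefix w x" "length x = length w + j"
      using pce_extension[OF assms(1), of w j] by (auto simp: short_words_def)
    then have "trim j x = w"
      by (auto simp: trim_def prefix_def)
    moreover have "x \<in> short_words L l"
      using x w assms(2) by (auto simp: short_words_def)
    ultimately show "w \<in> trim j ` short_words L l"
      by blast
  qed
qed

lemma card_short_words_Suc:
  assumes "finite A" "L \<subseteq> lists A"
  shows "card (short_words L (Suc l)) = card (short_words L l) + num_words L (Suc l)"
proof -
  have "short_words L (Suc l) = short_words L l \<union> {w \<in> L. length w = Suc l}"
    by (auto simp: short_words_def)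
  moreover have "finite {w \<in> L. length w = Suc l}"
    by (rule finite_subset[OF _ finite_short_words[OF assms, of "Suc l"]])
      (auto simp: short_words_def)
  moreover have "short_words L l \<inter> {w \<in> L. length w = Suc l} = {}"
    by (auto simp: short_words_def)
  ultimately show ?thesis
    using finite_short_words[OF assms, of l] by (simp add: card_Un_disjoint num_words_def)
qed

text \<open>Every nonempty word of length at most \<open>l + 1\<close> is a word of length at most \<open>l\<close> followed by a
  letter; the summand \<open>1\<close> in the factor absorbs the empty word.\<close>

lemma card_short_words_Suc_le:
  assumes "finite A" "L \<subseteq> lists A" "pce L" "L \<noteq> {}"
  shows "card (short_words L (Suc l)) \<le> (1 + card A) * card (short_words L l)"
proof -
  let ?S = "short_words L l"
  have fin: "finite ?S"
    by (rule finite_short_words[OF assms(1,2)])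
  have "short_words L (Suc l) \<subseteq> insert [] ((\<lambda>(x, a). x @ [a]) ` (?S \<times> A))"
  proof
    fix w assume w: "w \<in> short_words L (Suc l)"
    show "w \<in> insert [] ((\<lambda>(x, a). x @ [a]) ` (?S \<times> A))"
    proof (cases w rule: rev_cases)
      case (snoc x a)
      then have "x \<in> ?S" "a \<in> A"
        using w assms(2) pce_prefix[OF assms(3), of w x] by (auto simp: short_words_def)
      then show ?thesis
        using snoc by force
    qed simp
  qed
  then have "card (short_words L (Suc l)) \<le> card (insert [] ((\<lambda>(x, a). x @ [a]) ` (?S \<times> A)))"
    using fin assms(1) by (intro card_mono) auto
  also have "\<dots> \<le> Suc (card (?S \<times> A))"
    using fin assms(1) card_image_le[of "?S \<times> A" "\<lambda>(x, a). x @ [a]"]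
    by (auto simp: card_insert_if simp del: card_cartesian_product)
  also have "\<dots> \<le> (1 + card A) * card ?S"
  proof -
    have "[] \<in> ?S"
      using pce_Nil[OF assms(3,4)] by (simp add: short_words_def)
    then have "card ?S \<ge> 1"
      using fin by (metis One_nat_def Suc_leI card_gt_0_iff empty_iff)
    then show ?thesis
      by (simp add: card_cartesian_product algebra_simps)
  qed
  finally show ?thesis .
qed

section \<open>The sum of the carry propagations\<close>

lemma nth_word_enumerates:
  assumes "finite A" "L \<subseteq> lists A" "pce L" "L \<noteq> {}"
  shows "radix_enumerates L (nth_word L)"
  unfolding nth_word_def
  by (rule theI'[OF ex1_radix_enumerates[OF assms(1,2) pce_infinite[OF assms(3,4)]]])

context
  fixes L :: "'a::linorder list set" and w :: "nat \<Rightarrow> 'a list"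
  assumes enum: "radix_enumerates L w"
begin

lemma enum_in: "w i \<in> L"
  using enum by (auto simp: radix_enumerates_def)

lemma enum_less_iff: "radix_less (w i) (w j) \<longleftrightarrow> i < j"
  using enum radix_less_irrefl radix_less_trans unfolding radix_enumerates_def
  by (metis linorder_neqE_nat)

lemma enum_inj: "inj w"
  by (rule injI) (metis enum_less_iff radix_less_irrefl linorder_neqE_nat)

lemma enum_length_mono: "i \<le> j \<Longrightarrow> length (w i) \<le> length (w j)"
  using enum_less_iff[of i j] by (cases "i = j") (auto simp: radix_less_iff)

lemma enum_initial_segment:
  assumes "finite (short_words L l)"
  shows "w ` {..<card (short_words L l)} = short_words L l"
proof -
  define I where "I = {i. length (w i) \<le> l}"
  have img: "w ` I = short_words L l"
    using enum by (auto simp: I_def short_words_def radix_enumerates_def)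
  have card_I: "card I = card (short_words L l)"
    by (simp add: img[symmetric] card_image inj_on_subset[OF enum_inj])
  have fin: "finite I"
    using assms img inj_on_subset[OF enum_inj, of I] by (metis finite_imageD subset_UNIV)
  \<comment> \<open>A finite downward closed set of natural numbers is an initial segment.\<close>
  have down: "{..<i} \<subseteq> I" if "i \<in> I" for i
    using that enum_length_mono[of _ i] unfolding I_def
    by (auto intro: order.trans dest: less_imp_le)
  have "I = {..<card I}"
  proof (rule card_subset_eq)
    show "I \<subseteq> {..<card I}"
    proof
      fix i assume i: "i \<in> I"
      then have "card {..i} \<le> card I"
        using down[OF i] by (intro card_mono[OF fin]) (auto simp: le_less)
      then show "i \<in> {..<card I}"
        by simp
    qed
  qed auto
  then show ?thesis
    using img card_I by simp
qed

text \<open>If the length jumped by more than one, the successor with its last letter erased would be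
  a word of \<open>L\<close> strictly between the two.\<close>

lemma enum_length_Suc:
  assumes "pce L"
  shows "length (w (Suc i)) = length (w i) \<or> length (w (Suc i)) = Suc (length (w i))"
proof -
  have "length (w (Suc i)) \<le> Suc (length (w i))"
  proof (rule ccontr)
    assume neg: "\<not> ?thesis"
    have "trim 1 (w (Suc i)) \<in> L"
      by (rule pce_prefix[OF assms enum_in prefix_trim])
    then obtain k where k: "w k = trim 1 (w (Suc i))"
      using enum by (metis radix_enumerates_def imageE)
    have "radix_less (w k) (w (Suc i))"
      unfolding k radix_less_iff length_trim using neg by linarith
    then have "length (w k) \<le> length (w i)"
      by (intro enum_length_mono) (simp add: enum_less_iff)
    then show False
      using neg by (simp add: k)
  qed
  then show ?thesis
    using enum_length_mono[of i "Suc i"] by auto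
qed

text \<open>By monotonicity of erasing, all words erased between two equal ones are squeezed between
  them.\<close>

lemma enum_trim_contiguous:
  assumes "i \<le> k" "k \<le> m" "trim j (w i) = trim j (w m)"
  shows "trim j (w k) = trim j (w m)"
proof -
  have mono: "trim j (w a) = trim j (w b) \<or> radix_less (trim j (w a)) (trim j (w b))"
    if "a \<le> b" for a b
    using that trim_mono[of "w a" "w b" j] enum_less_iff[of a b] by (cases "a = b") auto
  show ?thesis
    using mono[OF assms(1)] mono[OF assms(2)] assms(3)
    by (metis radix_less_irrefl radix_less_trans)
qed

end

text \<open>A sequence that never returns to a value it has left changes exactly when it takes a new
  value; the first value comes without a change.\<close>

lemma card_changes_contiguous:
  fixes f :: "nat \<Rightarrow> 'b"
  assumes "\<And>i k m. i \<le> k \<Longrightarrow> k \<le> m \<Longrightarrow> f i = f m \<Longrightarrow> f k = f m"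
  shows "Suc (card {i. i < N \<and> f i \<noteq> f (Suc i)}) = card (f ` {..N})"
proof (induction N)
  case 0
  show ?case
    by simp
next
  case (Suc N)
  have img: "f ` {..Suc N} = insert (f (Suc N)) (f ` {..N})"
    by (simp add: atMost_Suc)
  have old: "f (Suc N) \<in> f ` {..N} \<longleftrightarrow> f N = f (Suc N)"
  proof
    assume "f (Suc N) \<in> f ` {..N}"
    then obtain i where "i \<le> N" "f i = f (Suc N)"
      by auto
    then show "f N = f (Suc N)"
      using assms[of i N "Suc N"] by simp
  next
    assume "f N = f (Suc N)"
    then show "f (Suc N) \<in> f ` {..N}"
      by (metis atMost_iff imageI order_refl)
  qed
  show ?case
  proof (cases "f N = f (Suc N)")
    case True
    then have "{i. i < Suc N \<and> f i \<noteq> f (Suc i)} = {i. i < N \<and> f i \<noteq> f (Suc i)}"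
      by (auto simp: less_Suc_eq)
    moreover have "f ` {..Suc N} = f ` {..N}"
      using img old True by (simp add: insert_absorb)
    ultimately show ?thesis
      using Suc.IH by simp
  next
    case False
    then have "{i. i < Suc N \<and> f i \<noteq> f (Suc i)} = insert N {i. i < N \<and> f i \<noteq> f (Suc i)}"
      by (auto simp: less_Suc_eq)
    then show ?thesis
      using Suc.IH img old False by simp
  qed
qed

text \<open>The window is the set of words of length at most \<open>l\<close>, followed by the first word of length
  \<open>l + 1\<close>. The erased word takes \<open>card (short_words L (l - j))\<close> values on the former and a new,
  longer one on the latter.\<close>

lemma card_trim_changes:
  assumes enum: "radix_enumerates L w" and "pce L" and fin: "finite (short_words L l)" and "j \<le> l"
  shows "card {i. i < card (short_words L l) \<and> trim j (w i) \<noteq> trim j (w (Suc i))}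
    = card (short_words L (l - j))"
proof -
  let ?N = "card (short_words L l)"
  have seg: "w ` {..<?N} = short_words L l"
    by (rule enum_initial_segment[OF enum fin])
  have "w ?N \<notin> short_words L l"
  proof
    assume "w ?N \<in> short_words L l"
    then obtain i where "i < ?N" "w i = w ?N"
      using seg by (metis imageE lessThan_iff)
    then show False
      using enum_inj[OF enum] by (simp add: inj_eq)
  qed
  then have "length (w ?N) > l"
    using enum_in[OF enum] by (auto simp: short_words_def)
  then have new: "trim j (w ?N) \<notin> short_words L (l - j)"
    using \<open>j \<le> l\<close> by (auto simp: short_words_def)
  have img: "(\<lambda>i. trim j (w i)) ` {..<?N} = short_words L (l - j)"
    using seg trim_short_words[OF \<open>pce L\<close> \<open>j \<le> l\<close>] by (simp add: image_image[symmetric])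
  then have "(\<lambda>i. trim j (w i)) ` {..?N} = insert (trim j (w ?N)) (short_words L (l - j))"
    by (simp add: lessThan_Suc_atMost[symmetric] lessThan_Suc)
  moreover have "finite (short_words L (l - j))"
    using img by (metis finite_imageI finite_lessThan)
  ultimately show ?thesis
    using new card_changes_contiguous[of "\<lambda>i. trim j (w i)" ?N]
      enum_trim_contiguous[OF enum] by simp
qed

lemma cp_eq_Delta:
  assumes "radix_enumerates L (nth_word L)"
  shows "cp L i = Delta (nth_word L i) (nth_word L (Suc i))"
proof -
  have "(THE k. nth_word L k = nth_word L i) = i"
    using enum_inj[OF assms] by (auto simp: inj_eq)
  then show ?thesis
    by (simp add: cp_def cp_word_def Succ_word_def)
qed

lemma sum_cp_short_words:
  assumes "finite A" "L \<subseteq> lists A" "pce L" "L \<noteq> {}"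
  shows "(\<Sum>i<card (short_words L l). cp L i) = (\<Sum>k\<le>l. card (short_words L k))"
proof -
  let ?N = "card (short_words L l)" and ?w = "nth_word L"
  have enum: "radix_enumerates L ?w"
    by (rule nth_word_enumerates[OF assms])
  have fin: "finite (short_words L l)"
    by (rule finite_short_words[OF assms(1,2)])
  let ?change = "\<lambda>j i. trim j (?w i) \<noteq> trim j (?w (Suc i))"
  have "cp L i = (\<Sum>j\<le>l. of_bool (?change j i))" if "i < ?N" for i
  proof -
    have "?w i \<in> short_words L l"
      using enum_initial_segment[OF enum fin] that by blast
    then have "length (?w (Suc i)) \<le> Suc l" "length (?w i) \<le> l"
      using enum_length_Suc[OF enum assms(3), of i] by (auto simp: short_words_def)
    then have "\<not> ?change j i" if "j > l" for j
      using that by (simp add: trim_def)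
    then have "{j. ?change j i} = {..l} \<inter> {j. ?change j i}"
      by (auto simp: not_le[symmetric])
    then have "card {j. ?change j i} = (\<Sum>j\<le>l. of_bool (?change j i))"
      by simp
    then show ?thesis
      using Delta_eq_card_trim[OF enum_length_Suc[OF enum assms(3), of i]]
      by (simp add: cp_eq_Delta[OF enum])
  qed
  then have "(\<Sum>i<?N. cp L i) = (\<Sum>i<?N. \<Sum>j\<le>l. of_bool (?change j i))"
    by simp
  also have "\<dots> = (\<Sum>j\<le>l. \<Sum>i<?N. of_bool (?change j i))"
    by (rule sum.swap)
  also have "\<dots> = (\<Sum>j\<le>l. card (short_words L (l - j)))"
  proof (rule sum.cong[OF refl])
    fix j assume "j \<in> {..l}"
    moreover have "{..<?N} \<inter> {i. ?change j i} = {i. i < ?N \<and> ?change j i}"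
      by auto
    ultimately show "(\<Sum>i<?N. of_bool (?change j i)) = card (short_words L (l - j))"
      using card_trim_changes[OF enum assms(3) fin, of j] by simp
  qed
  also have "\<dots> = (\<Sum>k\<le>l. card (short_words L k))"
    by (rule sum.nat_diff_reindex[where g = "\<lambda>k. card (short_words L k)", of "Suc l",
          simplified lessThan_Suc_atMost diff_Suc_Suc])
  finally show ?thesis .
qed

section \<open>Carry propagation and local growth rate\<close>

theorem corollary3p16:
  fixes A :: "'a::linorder set" and L :: "'a list set"
  assumes "finite A" and "L \<subseteq> lists A"
    and "pce L" and "L \<noteq> {}"
    and "convergent (cp_mean L)"
  shows "convergent (growth_ratio L) \<and>
         local_growth_rate L \<noteq> 1 \<and>
         CP L = local_growth_rate L / (local_growth_rate L - 1)"
proof -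
  let ?N = "\<lambda>l. card (short_words L l)"
  define v where "v l = real (?N l)" for l
  define C where "C = CP L"
  define g where "g = C / (C - 1)"
  have N_pos: "?N l > 0" for l
    using pce_Nil[OF assms(3,4)] finite_short_words[OF assms(1,2), of l]
    by (auto simp: card_gt_0_iff short_words_def)
  have v_pos: "v l > 0" for l
    using N_pos by (simp add: v_def)
  have num: "real (num_words L (Suc l)) = v (Suc l) - v l" for l
    using card_short_words_Suc[OF assms(1,2), of l] by (simp add: v_def)
  have "num_words L l > 0" for l
  proof -
    have "finite {w \<in> L. length w = l}"
      by (rule finite_subset[OF _ finite_short_words[OF assms(1,2), of l]])
        (auto simp: short_words_def)
    then show ?thesis
      using pce_word_of_length[OF assms(3,4), of l] by (auto simp: num_words_def card_gt_0_iff)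
  qed
  then have "strict_mono ?N"
    using card_short_words_Suc[OF assms(1,2)] by (simp add: strict_mono_Suc_iff)
  moreover have "cp_mean L \<longlonglongrightarrow> C"
    using assms(5) by (simp add: C_def CP_def convergent_LIMSEQ_iff)
  ultimately have "(\<lambda>l. cp_mean L (?N l)) \<longlonglongrightarrow> C"
    using LIMSEQ_subseq_LIMSEQ by (fastforce simp: o_def)
  moreover have "cp_mean L (?N l) = (\<Sum>k\<le>l. v k) / v l" for l
    using arg_cong[OF sum_cp_short_words[OF assms(1-4), of l], of real]
    by (simp add: cp_mean_def v_def)
  ultimately have lim: "(\<lambda>l. (\<Sum>k\<le>l. v k) / v l) \<longlonglongrightarrow> C"
    by simp
  have bound: "v (Suc l) \<le> real (1 + card A) * v l" for l
    unfolding v_def of_nat_mult[symmetric] of_nat_le_iff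
    by (rule card_short_words_Suc_le[OF assms(1-4)])
  note ratio = ratio_limit_of_partial_sum_ratio[OF v_pos bound lim]
  have g: "g > 1" "C = g / (g - 1)"
    using ratio(1) by (simp_all add: g_def field_simps)
  have "(\<lambda>l. growth_ratio L (Suc l)) \<longlonglongrightarrow> g"
    unfolding growth_ratio_def num
    by (rule ratio_limit_of_differences[OF v_pos ratio(2)[folded g_def] g(1)])
  then have growth: "growth_ratio L \<longlonglongrightarrow> g"
    by (rule LIMSEQ_imp_Suc)
  then have "local_growth_rate L = g"
    by (simp add: local_growth_rate_def limI)
  then show ?thesis
    using growth g by (auto simp: C_def convergent_def)
qed

end
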